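(* Let $\ell$ and $n$ be nonnegative integers and let $a$ be a complex number such that no zero factor appears in any denominator occurring in the identity below. Then $${}_3F_2\!\left[\begin{matrix}-n,\ a,\ 3a+n-\ell\\ \frac{3a}{2},\ \frac{1+3a}{2}-\ell\end{matrix}\,\Big|\,\frac34\right]=\frac{(1-3a-n)_\ell\,(\frac{1-3a}{2}-n)_\ell}{(1-3a-2n)_\ell\,(\frac{1-3a}{2})_\ell}\sum_{i=0}^{\ell}\frac{3a+2n-2i}{3a+2n}\,\frac{(-\ell)_i(-n)_i(-2n-3a)_i}{(1)_i(1-n-3a)_i(1+\ell-2n-3a)_i}\cdot\frac{(\frac13)_{\frac{n-i}{3}}(\frac23)_{\frac{n-i}{3}}}{(\frac13+a)_{\frac{n-i}{3}}(\frac23+a)_{\frac{n-i}{3}}}\,\chi(n-i).$$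
   Context: For complex $x$ and an integer $m$, the shifted factorial is $(x)_m=\prod_{k=0}^{m-1}(x+k)$ for $m>0$, $(x)_0=1$, and $(x)_m=(-1)^m/\prod_{k=1}^{-m}(k-x)$ for $m<0$. The hypergeometric series is ${}_3F_2\!\left[\begin{matrix}a_0,a_1,a_2\\ b_1,b_2\end{matrix}\,\Big|\,z\right]=\sum_{k=0}^\infty\frac{(a_0)_k(a_1)_k(a_2)_k}{k!\,(b_1)_k(b_2)_k}z^k$, with parameters such that no zero factors appear in the denominators of the summand; with $a_0=-n$ it is a finite sum over $0\le k\le n$. For an integer $N$, $\chi(N)=1$ if $3\mid N$ and $\chi(N)=0$ otherwise; a summand containing $\chi(n-i)=0$ is understood to be $0$, so only indices $i$ with $(n-i)/3\in\mathbb Z$ contribute. *)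

theory Defs
  imports "HOL-Analysis.Analysis"
begin

definition shifted_factorial :: "complex \<Rightarrow> int \<Rightarrow> complex" where
  "shifted_factorial x m =
     (if m \<ge> 0 then pochhammer x (nat m)
      else (- 1) ^ nat (- m) / (\<Prod>k = 1..nat (- m). of_nat k - x))"

text \<open>
  If \<open>a0 = - n\<close> for a natural number \<open>n\<close>, then \<open>pochhammer a0 k = 0\<close> for all \<open>k > n\<close>. Division
  by zero yields zero, so the series is then the finite sum over \<open>k \<le> n\<close>, even when a lower
  parameter makes a denominator vanish at some \<open>k > n\<close>.
\<close>

definition hypergeometric_3F2 ::
  "complex \<Rightarrow> complex \<Rightarrow> complex \<Rightarrow> complex \<Rightarrow> complex \<Rightarrow> complex \<Rightarrow> complex" where
  "hypergeometric_3F2 a0 a1 a2 b1 b2 z =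
     (\<Sum>k. pochhammer a0 k * pochhammer a1 k * pochhammer a2 k /
           (fact k * pochhammer b1 k * pochhammer b2 k) * z ^ k)"

definition chi3 :: "int \<Rightarrow> complex" where
  "chi3 N = (if 3 dvd N then 1 else 0)"

end

theory Submission
  imports Defs "HOL-Computational_Algebra.Formal_Power_Series"
begin

text \<open>
  For \<open>l = 0\<close> the identity is the Gessel--Stanton evaluation: \<open>(3a)\<^sub>n / n!\<close> times the series is the
  coefficient of \<open>x\<^sup>n\<close> in
  \<open>(1 - x)\<^bsup>-3a\<^esup> (1 + 3x / (1 - x)\<^sup>2)\<^bsup>-a\<^esup> = (1 - x\<^sup>3)\<^bsup>-a\<^esup>\<close>.
  For general \<open>l\<close>, a terminating very-well-poised \<open>4F3(1)\<close> summation with \<open>A = -2n - 3a\<close> and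
  \<open>b = k - n\<close> expands the \<open>k\<close>-th summand as a combination over \<open>i \<le> l\<close> of the \<open>k\<close>-th summands of the
  case \<open>l = 0\<close> with \<open>n - i\<close> in place of \<open>n\<close>. This argument divides by quantities that may vanish for
  admissible \<open>a\<close>, but never for nonreal \<open>a\<close>; the remaining \<open>a\<close> follow by continuity.
\<close>

section \<open>Generating function of the case \<open>l = 0\<close>\<close>

unbundle fps_syntax and no vec_syntax

text \<open>The power series of \<open>(1 - x)\<^bsup>-c\<^esup>\<close>.\<close>

definition fps_geometric_power :: "'a::field_char_0 \<Rightarrow> 'a fps" where
  "fps_geometric_power c = Abs_fps (\<lambda>n. pochhammer c n / fact n)"

lemma fps_geometric_power_nth: "fps_geometric_power c $ n = pochhammer c n / fact n"
  by (simp add: fps_geometric_power_def)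

lemma fps_geometric_power_0: "fps_geometric_power 0 = 1"
  by (rule fps_ext) (auto simp: fps_geometric_power_nth pochhammer_0_left)

text \<open>Coefficient by coefficient this is the Chu-Vandermonde convolution.\<close>

lemma fps_geometric_power_add:
  "fps_geometric_power c * fps_geometric_power d = fps_geometric_power (c + d)"
proof (rule fps_ext)
  fix n
  show "(fps_geometric_power c * fps_geometric_power d) $ n = fps_geometric_power (c + d) $ n"
    by (simp add: fps_mult_nth fps_geometric_power_nth pochhammer_binomial_sum atLeast0AtMost
        sum_divide_distrib binomial_fact field_simps)
qed

lemma fps_geometric_power_of_nat:
  "fps_geometric_power c ^ k = fps_geometric_power (of_nat k * c)"
  by (induction k) (simp_all add: fps_geometric_power_0 fps_geometric_power_add algebra_simps)

lemma fps_geometric_power_deriv: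
  "fps_deriv (fps_geometric_power c) = fps_const c * fps_geometric_power (c + 1)"
  by (rule fps_ext) (simp add: fps_geometric_power_nth pochhammer_rec field_simps del: of_nat_Suc)

lemma fps_geometric_power_Suc:
  "(1 - fps_X) * fps_geometric_power (c + 1) = fps_geometric_power c"
proof -
  have "(1 - fps_X) * fps_geometric_power (1 :: 'a) = 1"
    by (rule fps_ext)
       (simp add: fps_geometric_power_nth pochhammer_fact[symmetric] algebra_simps fps_X_mult_nth)
  thus ?thesis
    by (metis fps_geometric_power_add mult.assoc mult.commute mult_1)
qed

text \<open>Since \<open>g\<close> has no constant term, \<open>g ^ k\<close> has no coefficient
  below index \<open>k\<close>. The inner sums can therefore all be extended to the same bound
  \<open>n\<close> and interchanged with the convolution.\<close>

lemma fps_compose_mult_nth: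
  fixes f g h :: "'a::comm_ring_1 fps"
  assumes "g $ 0 = 0"
  shows "((f oo g) * h) $ n = (\<Sum>k=0..n. f $ k * (g ^ k * h) $ n)"
proof -
  have "((f oo g) * h) $ n = (\<Sum>m=0..n. (\<Sum>k=0..m. f $ k * g ^ k $ m) * h $ (n - m))"
    by (simp add: fps_mult_nth fps_compose_nth)
  also have "\<dots> = (\<Sum>m=0..n. (\<Sum>k=0..n. f $ k * g ^ k $ m) * h $ (n - m))"
    by (intro sum.cong refl arg_cong2[where f = "(*)"] sum.mono_neutral_left)
       (use startsby_zero_power_prefix[OF assms] in auto)
  also have "\<dots> = (\<Sum>k=0..n. f $ k * (g ^ k * h) $ n)"
    unfolding sum_distrib_right sum_distrib_left fps_mult_nth
    by (subst sum.swap) (simp add: mult.assoc)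
  finally show ?thesis .
qed

text \<open>This is the linear differential equation of (1 - X^3)^(-a). It stands in for the closed
  form because it asks only for the derivative of each factor, not for a power law with exponent
  \<open>a\<close> for composed series.\<close>

lemma gessel_stanton_fps_deriv:
  fixes a :: "'a::field_char_0"
  defines "F \<equiv> (fps_geometric_power a oo (- 3 * fps_X * fps_geometric_power 2)) *
      fps_geometric_power (3 * a)"
  shows "(1 - fps_X ^ 3) * fps_deriv F = fps_const (3 * a) * fps_X\<^sup>2 * F"
proof -
  define V :: "'a fps" where "V = - 3 * fps_X * fps_geometric_power 2"
  define H where "H = fps_geometric_power a oo V"
  define P where "P = fps_geometric_power (3 * a)"
  define y :: "'a fps" where "y = 1 - fps_X"
  have V0: "V $ 0 = 0" by (simp add: V_def)
  have y3: "y * fps_geometric_power 3 = fps_geometric_power 2"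
    using fps_geometric_power_Suc[of 2] by (simp add: y_def)
  have y2: "y * fps_geometric_power 2 = fps_geometric_power 1"
    using fps_geometric_power_Suc[of 1] by (simp add: y_def)
  have y1: "y * fps_geometric_power 1 = 1"
    using fps_geometric_power_Suc[of 0] by (simp add: y_def fps_geometric_power_0)
  have yP: "y * fps_geometric_power (3 * a + 1) = P"
    using fps_geometric_power_Suc[of "3 * a"] by (simp add: y_def P_def)
  \<comment> \<open>Composing \<open>fps_geometric_power_Suc\<close> with \<open>V\<close> lowers
    the exponent \<open>a + 1\<close> that differentiation produces, so the derivative of
    \<open>H\<close> can be expressed through \<open>H\<close> itself.\<close>
  have "(1 - V) * (fps_geometric_power (a + 1) oo V) = H"
    unfolding H_def fps_geometric_power_Suc[of a, symmetric]
    by (simp add: fps_compose_mult_distrib[OF V0] fps_compose_sub_distrib fps_X_fps_compose_startby0[OF V0])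
  moreover have "fps_deriv H = fps_const a * (fps_geometric_power (a + 1) oo V) * fps_deriv V"
    unfolding H_def using V0
    by (simp add: fps_compose_deriv fps_geometric_power_deriv fps_compose_mult_distrib)
  ultimately have H': "(1 - V) * fps_deriv H = fps_const a * fps_deriv V * H"
    by (metis mult.assoc mult.commute)
  \<comment> \<open>Multiplication by powers of \<open>y\<close> clears the denominators in
    \<open>V\<close> and in its derivative. In particular \<open>1 - V\<close> becomes
    \<open>y\<^sup>2 + 3 * fps_X\<close>, which is 1 + X + X^2.\<close>
  have y22: "y\<^sup>2 * fps_geometric_power 2 = 1"
    using y1 y2 by (simp add: power2_eq_square mult.assoc)
  have y33: "y ^ 3 * fps_geometric_power 3 = 1"
    using y1 y2 y3 by (simp add: power3_eq_cube mult.assoc)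
  have yV: "y\<^sup>2 * (1 - V) = y\<^sup>2 + 3 * fps_X" unfolding V_def using y22 by algebra
  have dV: "fps_deriv V = - 3 * fps_geometric_power 2 - 6 * fps_X * fps_geometric_power 3"
  proof -
    have "fps_const 2 = (2 :: 'a fps)" "fps_deriv 3 = (0 :: 'a fps)"
      by (simp_all add: numeral_fps_const)
    thus ?thesis by (simp add: V_def fps_geometric_power_deriv algebra_simps)
  qed
  have ydV: "y ^ 3 * fps_deriv V = - 3 * y - 6 * fps_X"
  proof -
    have "y ^ 3 * fps_deriv V = - 3 * y * (y\<^sup>2 * fps_geometric_power 2)
        - 6 * fps_X * (y ^ 3 * fps_geometric_power 3)"
      unfolding dV by (simp add: power2_eq_square power3_eq_cube algebra_simps)
    thus ?thesis unfolding y22 y33 by simp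
  qed
  have yH: "y * (y\<^sup>2 + 3 * fps_X) * fps_deriv H = fps_const a * (- 3 * y - 6 * fps_X) * H"
  proof -
    have "y * (y\<^sup>2 * (1 - V)) * fps_deriv H = y ^ 3 * ((1 - V) * fps_deriv H)"
      by (simp add: power2_eq_square power3_eq_cube mult_ac)
    thus ?thesis unfolding H' yV ydV[symmetric] by (simp add: mult_ac)
  qed
  have c: "fps_const (3 * a) = 3 * fps_const a" by (simp add: numeral_fps_const)
  have "fps_deriv F = fps_deriv H * P + H * (fps_const (3 * a) * fps_geometric_power (3 * a + 1))"
    unfolding F_def V_def[symmetric] H_def[symmetric]
    by (simp add: fps_geometric_power_deriv P_def)
  hence "y * fps_deriv F = y * fps_deriv H * P + fps_const (3 * a) * H *
      (y * fps_geometric_power (3 * a + 1))"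
    by (simp add: distrib_left mult_ac)
  hence yF: "y * fps_deriv F = y * fps_deriv H * P + 3 * fps_const a * H * P"
    unfolding c yP .
  have F: "F = H * P" by (simp add: F_def H_def P_def V_def)
  \<comment> \<open>This is the factorization (1 + X + X^2)(1 - X), where the cube in the generating
    function comes from.\<close>
  have "1 - fps_X ^ 3 = (y\<^sup>2 + 3 * fps_X) * y" unfolding y_def by algebra
  hence "(1 - fps_X ^ 3) * fps_deriv F = (y\<^sup>2 + 3 * fps_X) * (y * fps_deriv F)"
    by (simp add: mult.assoc)
  also have "\<dots> = y * (y\<^sup>2 + 3 * fps_X) * fps_deriv H * P + 3 * fps_const a * (y\<^sup>2 + 3 * fps_X) * F"
    unfolding yF unfolding F by (simp add: algebra_simps)
  also have "\<dots> = 3 * fps_const a * (y\<^sup>2 + 3 * fps_X - y - 2 * fps_X) * F"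
    unfolding yH F by (simp add: algebra_simps)
  also have "y\<^sup>2 + 3 * fps_X - y - 2 * fps_X = fps_X\<^sup>2"
    unfolding y_def by algebra
  finally show ?thesis unfolding c .
qed

text \<open>The \<open>k\<close>-th term of \<open>f n\<close> arises from V^k (1 - X)^(-3a) =
  (-3X)^k (1 - X)^(-3a-2k). Comparing coefficients in the differential equation then gives a
  recurrence with step 3 and initial values 1, 0, 0.\<close>

lemma gessel_stanton_coefficient:
  fixes a :: "'a::field_char_0" and n :: nat
  defines "f \<equiv> \<lambda>n. \<Sum>k=0..n. pochhammer a k / fact k * (- 3) ^ k *
      (pochhammer (3 * a + 2 * of_nat k) (n - k) / fact (n - k))"
  shows "f n = (if 3 dvd n then pochhammer a (n div 3) / fact (n div 3) else 0)"
proof -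
  define F where "F = (fps_geometric_power a oo (- 3 * fps_X * fps_geometric_power 2)) *
      fps_geometric_power (3 * a)"
  have F_nth: "F $ n = f n" for n
  proof -
    have pow: "(- 3 * fps_X * fps_geometric_power 2) ^ k * fps_geometric_power (3 * a)
        = fps_const ((- 3) ^ k) * (fps_X ^ k * fps_geometric_power (3 * a + 2 * of_nat k))" for k
    proof -
      have "- 3 = (fps_const (- 3) :: 'a fps)"
        by (simp add: numeral_fps_const)
      show ?thesis
        unfolding \<open>- 3 = fps_const (- 3)\<close> power_mult_distrib fps_geometric_power_of_nat fps_const_power
        by (simp add: mult.assoc mult.commute[of _ 2] add.commute fps_geometric_power_add)
    qed
    show ?thesis unfolding F_def f_def
      by (subst fps_compose_mult_nth, simp, unfold pow)
         (auto simp: fps_X_power_mult_nth fps_geometric_power_nth intro!: sum.cong)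
  qed
  have eq: "(1 - fps_X ^ 3) * fps_deriv F = fps_const (3 * a) * fps_X\<^sup>2 * F"
    unfolding F_def by (rule gessel_stanton_fps_deriv)
  have eq_nth: "fps_deriv F $ n - (if n < 3 then 0 else fps_deriv F $ (n - 3)) =
        3 * a * (if n < 2 then 0 else F $ (n - 2))" for n
  proof -
    have "((1 - fps_X ^ 3) * fps_deriv F) $ n = (fps_const (3 * a) * (fps_X\<^sup>2 * F)) $ n"
      by (simp add: eq mult.assoc)
    thus ?thesis by (simp add: left_diff_distrib fps_X_power_mult_nth)
  qed
  have f0: "f 0 = 1" by (simp add: f_def)
  have f1: "f 1 = 0" using eq_nth[of 0] by (simp add: F_nth)
  have f2: "f 2 = 0" using eq_nth[of 1] by (simp add: F_nth numeral_2_eq_2)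
  \<comment> \<open>Coefficient \<open>n + 2\<close> of the equation contributes (n + 3) f(n + 3) -
    n f(n) = 3a f(n). For \<open>n = 0\<close> the middle term is absent, hence the case
    split.\<close>
  have step: "of_nat (n + 3) * f (n + 3) = (3 * a + of_nat n) * f n" for n
    using eq_nth[of "n + 2"] by (cases n) (simp_all add: F_nth numeral_eq_Suc algebra_simps)
  show ?thesis
  proof (induction n rule: less_induct)
    case (less n)
    consider "n = 0" | "n = 1" | "n = 2" | m where "n = m + 3"
      by (metis One_nat_def add.commute le_add_diff_inverse less_Suc_eq less_one
          linorder_not_le numeral_2_eq_2 numeral_3_eq_3)
    thus ?case
    proof cases
      case (4 m)
      have "of_nat n * f n = (3 * a + of_nat m) * f m" using step[of m] 4 by simp
      moreover have "of_nat n \<noteq> (0 :: 'a)" unfolding of_nat_eq_0_iff using 4 by simp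
      ultimately have fn: "f n = (3 * a + of_nat m) * f m / of_nat n"
        by (simp add: eq_divide_eq mult.commute)
      show ?thesis
      proof (cases "3 dvd m")
        case True
        then obtain q where q: "m = 3 * q" by blast
        have n: "n = 3 * Suc q" using 4 q by simp
        have "f n = (3 * (a + of_nat q)) * (pochhammer a q / fact q) / (3 * of_nat (Suc q))"
          using less[of m] fn n q by (simp add: distrib_left)
        also have "\<dots> = (a + of_nat q) * (pochhammer a q / fact q) / of_nat (Suc q)"
          by (subst mult.assoc, subst mult_divide_mult_cancel_left) simp_all
        also have "\<dots> = pochhammer a (Suc q) / fact (Suc q)"
          by (simp add: pochhammer_Suc mult.commute del: of_nat_Suc)
        finally show ?thesis using n by simp
      qed (use less[of m] fn 4 in auto)
    qed (use f0 f1 f2 in auto)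
  qed
qed

section \<open>Identities for shifted factorials\<close>

text \<open>The factors are grouped by the residue of their index modulo 3, and each contributes a
  factor 3.\<close>

lemma pochhammer_triple:
  fixes a :: "'a::field_char_0"
  shows "pochhammer (3 * a) (3 * m) =
    27 ^ m * pochhammer a m * pochhammer (1 / 3 + a) m * pochhammer (2 / 3 + a) m"
proof (induction m)
  case (Suc m)
  have "3 * Suc m = Suc (Suc (Suc (3 * m)))" by simp
  have "pochhammer (3 * a) (3 * Suc m) = pochhammer (3 * a) (3 * m) *
      ((3 * a + 3 * of_nat m) * (3 * a + 3 * of_nat m + 1) * (3 * a + 3 * of_nat m + 2))"
    unfolding \<open>3 * Suc m = _\<close> by (simp add: pochhammer_Suc algebra_simps)
  also have "(3 * a + 3 * of_nat m) * (3 * a + 3 * of_nat m + 1) * (3 * a + 3 * of_nat m + 2) =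
      27 * ((a + of_nat m) * (1 / 3 + a + of_nat m) * (2 / 3 + a + of_nat m))"
    by (simp add: field_simps)
  finally show ?case unfolding Suc by (simp add: pochhammer_Suc mult_ac)
qed simp

lemma fact_triple:
  "fact (3 * m) = (27 ^ m * fact m * pochhammer (1 / 3) m * pochhammer (2 / 3) m :: 'a::field_char_0)"
  using pochhammer_triple[of "1 / 3 :: 'a" m] by (simp add: pochhammer_fact mult_ac)

text \<open>By reflection, both sides are (-1)^i times
  \<open>pochhammer (x - of_nat i) (i + k)\<close>, split after \<open>i\<close> factors on the left
  and after \<open>k\<close> on the right. The identity serves to trade a shift by \<open>i\<close>
  in the parameter for a shift by \<open>k\<close>.\<close>

lemma pochhammer_reflect_shift:
  fixes x :: "'a::comm_ring_1"
  shows "pochhammer (1 - x) i * pochhammer x k =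
    pochhammer (x - of_nat i) k * pochhammer (1 - x - of_nat k) i"
proof -
  have refl: "pochhammer (1 - y) i = (- 1) ^ i * pochhammer (y - of_nat i) i" for y :: 'a
    using pochhammer_minus[of "y - 1" i] by simp
  have "pochhammer (x - of_nat i) i * pochhammer x k =
      pochhammer (x - of_nat i) k * pochhammer (x + of_nat k - of_nat i) i"
    using pochhammer_product'[of "x - of_nat i" i k] pochhammer_product'[of "x - of_nat i" k i]
    by (simp add: add.commute algebra_simps)
  thus ?thesis
    unfolding diff_diff_eq refl by (simp add: mult.assoc mult.left_commute[of _ "(- 1) ^ i"])
qed

section \<open>A terminating very-well-poised summation\<close>

text \<open>
  The pair \<open>(F, G)\<close> is a WZ pair: \<open>F l i\<close> is the summand of the very-well-poised sum divided by its
  closed form.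
\<close>

lemma well_poised_4F3_step:
  fixes A b :: "'a::field_char_0" and l :: nat
  assumes A: "\<And>k. pochhammer A k \<noteq> 0"
    and Ab: "\<And>k. pochhammer (1 + A - b) k \<noteq> 0"
    and hb: "\<And>k. pochhammer ((1 + A) / 2 - b) k \<noteq> 0"
  defines "K \<equiv> \<lambda>l. pochhammer (1 + A - b) l * pochhammer ((1 + A) / 2) l /
      pochhammer ((1 + A) / 2 - b) l"
  defines "F \<equiv> \<lambda>l i. (- 1) ^ i * (A + 2 * of_nat i) * (pochhammer A i / A) * pochhammer b i /
      pochhammer (1 + A - b) i * of_nat (l choose i) / pochhammer (1 + A) (l + i) * K l"
  defines "G \<equiv> \<lambda>l j. (- 1) ^ j * ((1 + A) / 2 + of_nat j) * pochhammer (1 + A) j * pochhammer b (Suc j) *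
      of_nat (l choose j) / (pochhammer (1 + A - b) j * pochhammer (1 + A) (l + Suc j)) *
      K l / ((1 + A) / 2 - b + of_nat l)"
  shows "(\<Sum>i=0..m. F (Suc l) i - F l i) = G l m"
proof (induction m)
  have A_ne: "A + of_nat k \<noteq> 0" for k using A[of "Suc k"] by (simp add: pochhammer_Suc)
  have Ab_ne: "1 + A - b + of_nat k \<noteq> 0" for k using Ab[of "Suc k"] by (simp add: pochhammer_Suc)
  have hb_ne: "(1 + A) / 2 - b + of_nat k \<noteq> 0" for k using hb[of "Suc k"] by (simp add: pochhammer_Suc)
  have A0: "A \<noteq> 0" using A_ne[of 0] by simp
  have P: "pochhammer A (Suc k) / A = pochhammer (1 + A) k" for k
    using A0 by (simp add: pochhammer_rec add.commute)
  have E_ne: "pochhammer (1 + A) k \<noteq> 0" for k unfolding P[symmetric] using A[of "Suc k"] A0 by simp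
  have K_Suc: "K (Suc l) = K l * ((1 + A - b + of_nat l) * ((1 + A) / 2 + of_nat l)) /
      ((1 + A) / 2 - b + of_nat l)" for l
    by (simp add: K_def pochhammer_Suc)
  {
    case 0
    define h where "h = (1 + A) / 2 - b + of_nat l"
    have "h \<noteq> 0" unfolding h_def by (rule hb_ne)
    have ne: "1 + A + of_nat l \<noteq> 0" using A_ne[of "Suc l"] by (simp add: algebra_simps)
    \<comment> \<open>What remains of the bracket is exactly the pair of factors \<open>b\<close>
      and \<open>(1 + A) / 2\<close> in the numerator of \<open>G l 0\<close>.\<close>
    have id: "(1 + A - b + of_nat l) * ((1 + A) / 2 + of_nat l) - (1 + A + of_nat l) * h = b * ((1 + A) / 2)"
      unfolding h_def by (simp add: field_simps)
    have "F (Suc l) 0 - F l 0 = K l / (pochhammer (1 + A) l * (1 + A + of_nat l) * h) *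
        ((1 + A - b + of_nat l) * ((1 + A) / 2 + of_nat l) - (1 + A + of_nat l) * h)"
      using A0 E_ne[of l] ne \<open>h \<noteq> 0\<close> unfolding F_def K_Suc h_def[symmetric]
      by (simp add: pochhammer_Suc divide_simps) (simp add: algebra_simps)
    also have "\<dots> = G l 0"
      unfolding id G_def h_def[symmetric] by (simp add: pochhammer_Suc mult_ac)
    finally show ?case by simp
  next
    case (Suc m)
    define h where "h = (1 + A) / 2 - b + of_nat l"
    have h0: "h \<noteq> 0" unfolding h_def by (rule hb_ne)
    define d where "d = 1 + A - b + of_nat m"
    have d0: "d \<noteq> 0" unfolding d_def by (rule Ab_ne)
    define e where "e = 2 + A + of_nat l + of_nat m"
    have e0: "e \<noteq> 0" unfolding e_def using A_ne[of "Suc (Suc (l + m))"] by (simp add: algebra_simps)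
    \<comment> \<open>Both neighbouring binomial coefficients \<open>l choose m\<close> and
      \<open>l choose Suc m\<close> are polynomial multiples of \<open>r\<close>, also when
      \<open>m > l\<close>.\<close>
    define r where "r = (of_nat (l choose m) / of_nat (Suc m) :: 'a)"
    have C: "of_nat (l choose m) = (of_nat m + 1) * r"
    proof -
      have "(of_nat m + 1 :: 'a) = of_nat (Suc m)" by simp
      thus ?thesis by (simp add: r_def del: of_nat_Suc)
    qed
    have C1: "of_nat (l choose Suc m) = (of_nat l - of_nat m) * r"
    proof (cases "m \<le> l")
      case True
      have "Suc m * (l choose Suc m) = (l - m) * (l choose m)"
        by (metis binomial_absorption binomial_absorb_comp)
      hence "of_nat (Suc m) * of_nat (l choose Suc m) = (of_nat (l - m) * of_nat (l choose m) :: 'a)"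
        by (metis of_nat_mult)
      thus ?thesis using True by (simp add: r_def of_nat_diff field_simps del: of_nat_Suc)
    qed (simp add: r_def binomial_eq_0)
    define D where "D = pochhammer (1 + A - b) m"
    define E where "E = pochhammer (1 + A) (l + Suc m)"
    \<comment> \<open>\<open>X\<close> is common to the four terms of the WZ equation. The cofactors
      are rational, with denominators built from \<open>d\<close>, \<open>e\<close> and
      \<open>h\<close> only.\<close>
    define X where "X = (- 1) ^ m * pochhammer (1 + A) m * pochhammer b (Suc m) * r * K l / (D * E)"
    define u where "u = A + 2 * of_nat (Suc m)"
    define q where "q = (of_nat l - of_nat m :: 'a)"
    define v where "v = (1 + A - b + of_nat l) * ((1 + A) / 2 + of_nat l)"
    define g where "g = (1 + A) / 2 + of_nat m"
    define g' where "g' = (1 + A) / 2 + of_nat (Suc m)"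
    define s where "s = 1 + A + of_nat m"
    define t where "t = b + of_nat (Suc m)"
    define l' where "l' = (of_nat l + 1 :: 'a)"
    define m' where "m' = (of_nat m + 1 :: 'a)"
    have D_Suc: "pochhammer (1 + A - b) (Suc m) = D * d"
      by (simp add: D_def d_def pochhammer_Suc)
    have E_Suc: "pochhammer (1 + A) (Suc l + Suc m) = E * e"
      "pochhammer (1 + A) (l + Suc (Suc m)) = E * e"
      by (simp_all add: E_def e_def pochhammer_Suc algebra_simps)
    have b_Suc: "pochhammer b (Suc (Suc m)) = pochhammer b (Suc m) * t"
      by (simp only: t_def pochhammer_Suc[of b "Suc m"])
    have P_Suc: "pochhammer (1 + A) (Suc m) = pochhammer (1 + A) m * s"
      by (simp only: s_def pochhammer_Suc)
    have C': "of_nat (Suc l choose Suc m) = l' * r"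
      using C C1 by (simp add: l'_def algebra_simps)
    have 1: "F l (Suc m) = - X * (u * q) / d"
      unfolding F_def P C1 D_Suc X_def u_def[symmetric] q_def[symmetric] E_def[symmetric]
      by (simp add: mult_ac)
    have 2: "F (Suc l) (Suc m) = - X * (u * l' * v) / (d * e * h)"
      unfolding F_def P C' D_Suc E_Suc K_Suc X_def u_def[symmetric] h_def[symmetric] v_def[symmetric]
      by (simp add: mult_ac)
    have 3: "G l m = X * (g * m') / h"
      unfolding G_def X_def C h_def[symmetric] g_def[symmetric] m'_def[symmetric] D_def[symmetric]
        E_def[symmetric]
      by (simp add: mult_ac)
    have 4: "G l (Suc m) = - X * (g' * s * t * q) / (d * e * h)"
      unfolding G_def X_def C1 D_Suc E_Suc b_Suc P_Suc h_def[symmetric] g'_def[symmetric] q_def[symmetric]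
      by (simp add: mult_ac)
    \<comment> \<open>This polynomial identity is the WZ equation after removal of the factor
      \<open>X / (d * e * h)\<close>. Expressing \<open>A\<close> through its half \<open>c\<close>
      makes all coefficients integral.\<close>
    have "- (u * l' * v) + u * q * e * h + g * m' * d * e + g' * s * t * q = 0"
    proof -
      define c where "c = (1 + A) / 2"
      have A_c: "A = 2 * c - 1" by (simp add: c_def field_simps)
      show ?thesis
        unfolding u_def l'_def v_def q_def e_def h_def g_def m'_def d_def g'_def s_def t_def
          c_def[symmetric] unfolding A_c of_nat_Suc by algebra
    qed
    moreover have "- X * p1 / (d * e * h) - - X * p2 / d + X * p3 / h - - X * p4 / (d * e * h) =
        X / (d * e * h) * (- p1 + p2 * e * h + p3 * d * e + p4)" for p1 p2 p3 p4
      using h0 d0 e0 by (simp add: field_simps)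
    ultimately have "F (Suc l) (Suc m) - F l (Suc m) + G l m - G l (Suc m) = 0"
      unfolding 1 2 3 4 by simp
    thus ?case using Suc by (simp add: algebra_simps)
  }
qed

text \<open>This is the terminating very-well-poised 5F4(1) sum with c = (1 + A)/2, where c cancels
  against 1 + A - c. The WZ pair shows that the normalized sum does not depend on \<open>l\<close>,
  and at \<open>l = 0\<close> it is 1.\<close>

lemma well_poised_4F3:
  fixes A b :: "'a::field_char_0" and l :: nat
  assumes A: "\<And>k. pochhammer A k \<noteq> 0"
    and Ab: "\<And>k. pochhammer (1 + A - b) k \<noteq> 0"
    and hA: "\<And>k. pochhammer ((1 + A) / 2) k \<noteq> 0"
    and hb: "\<And>k. pochhammer ((1 + A) / 2 - b) k \<noteq> 0"
  shows "(\<Sum>i=0..l. (A + 2 * of_nat i) / A *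
      (pochhammer (- of_nat l) i * pochhammer b i * pochhammer A i /
            (fact i * pochhammer (1 + A - b) i * pochhammer (1 + A + of_nat l) i))) =
      pochhammer (1 + A) l * pochhammer ((1 + A) / 2 - b) l /
        (pochhammer (1 + A - b) l * pochhammer ((1 + A) / 2) l)"
proof -
  define K where "K = (\<lambda>l. pochhammer (1 + A - b) l * pochhammer ((1 + A) / 2) l /
      pochhammer ((1 + A) / 2 - b) l)"
  define F where "F = (\<lambda>l i. (- 1) ^ i * (A + 2 * of_nat i) * (pochhammer A i / A) * pochhammer b i /
      pochhammer (1 + A - b) i * of_nat (l choose i) / pochhammer (1 + A) (l + i) * K l)"
  have A0: "A \<noteq> 0" using A[of 1] by simp
  have E_ne: "pochhammer (1 + A) k \<noteq> 0" for k
    using A[of "Suc k"] by (simp add: pochhammer_rec add.commute)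
  have one: "(\<Sum>i=0..l. F l i) = 1" for l
  proof (induction l)
    case 0
    show ?case using A0 by (simp add: F_def K_def)
  next
    case (Suc l)
    \<comment> \<open>At the upper limit \<open>Suc l\<close> the telescoped value contains
      \<open>l choose Suc l\<close>, which is zero.\<close>
    have "(\<Sum>i=0..Suc l. F (Suc l) i - F l i) = 0"
      unfolding F_def K_def by (subst well_poised_4F3_step[OF A Ab hb]) simp
    moreover have "F l (Suc l) = 0" by (simp add: F_def)
    ultimately show ?case using Suc by (simp add: sum_subtractf)
  qed
  have K0: "K l \<noteq> 0" using Ab hA hb by (simp add: K_def)
  have "(A + 2 * of_nat i) / A *
      (pochhammer (- of_nat l) i * pochhammer b i * pochhammer A i /
            (fact i * pochhammer (1 + A - b) i * pochhammer (1 + A + of_nat l) i)) =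
        F l i * (pochhammer (1 + A) l / K l)" for i
  proof -
    \<comment> \<open>The other conversion is the splitting of
      \<open>pochhammer (1 + A) (l + i)\<close> after its first \<open>l\<close> factors.\<close>
    have "pochhammer (- of_nat l) i / fact i = (- 1) ^ i * (of_nat (l choose i) :: 'a)"
      by (simp add: binomial_gbinomial gbinomial_pochhammer)
    thus ?thesis using E_ne[of l] K0 unfolding F_def pochhammer_product'
      by (simp add: divide_simps mult_ac)
  qed
  hence "(\<Sum>i=0..l. (A + 2 * of_nat i) / A *
      (pochhammer (- of_nat l) i * pochhammer b i * pochhammer A i /
            (fact i * pochhammer (1 + A - b) i * pochhammer (1 + A + of_nat l) i))) = pochhammer (1 + A) l / K l"
    by (simp only: one mult_1 flip: sum_distrib_right)
  thus ?thesis by (simp add: K_def mult_ac)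
qed

section \<open>The evaluation for \<open>l = 0\<close>\<close>

lemma gessel_stanton:
  fixes a :: "'a::field_char_0" and n :: nat
  assumes a: "\<And>k. pochhammer (3 * a) k \<noteq> 0"
  shows "(\<Sum>k=0..n. pochhammer (- of_nat n) k * pochhammer a k * pochhammer (3 * a + of_nat n) k /
            (fact k * pochhammer (3 * a / 2) k * pochhammer ((1 + 3 * a) / 2) k) * (3 / 4) ^ k) =
         (if 3 dvd n then pochhammer (1 / 3) (n div 3) * pochhammer (2 / 3) (n div 3) /
            (pochhammer (1 / 3 + a) (n div 3) * pochhammer (2 / 3 + a) (n div 3)) else 0)"
proof -
  have term_eq: "pochhammer (- of_nat n) k * pochhammer a k * pochhammer (3 * a + of_nat n) k /
          (fact k * pochhammer (3 * a / 2) k * pochhammer ((1 + 3 * a) / 2) k) * (3 / 4) ^ k =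
        fact n / pochhammer (3 * a) n * (pochhammer a k / fact k * (- 3) ^ k *
          (pochhammer (3 * a + 2 * of_nat k) (n - k) / fact (n - k)))" if "k \<le> n" for k
  proof -
    \<comment> \<open>Duplication merges the two lower parameters. The resulting
      \<open>4 ^ k\<close> cancels the denominator of \<open>(3 / 4) ^ k\<close>, and the sign of
      \<open>pochhammer (- of_nat n) k\<close> turns \<open>3 ^ k\<close> into
      \<open>(- 3) ^ k\<close>.\<close>
    have half: "pochhammer (3 * a) (2 * k) =
        4 ^ k * (pochhammer (3 * a / 2) k * pochhammer ((1 + 3 * a) / 2) k)"
      using pochhammer_double[of "3 * a / 2" k]
      by (simp add: power_mult add_divide_distrib add.commute mult.assoc)
    have "pochhammer (- of_nat n) k / fact k = ((- 1) ^ k * of_nat (n choose k) :: 'a)"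
      by (simp add: binomial_gbinomial gbinomial_pochhammer)
    hence neg: "pochhammer (- of_nat n) k = ((- 1) ^ k * fact n / fact (n - k) :: 'a)"
      using that by (simp add: binomial_fact field_simps)
    \<comment> \<open>A product of \<open>n + k\<close> consecutive factors is split again after
      \<open>2 * k\<close> of them.\<close>
    have "pochhammer (3 * a) n * pochhammer (3 * a + of_nat n) k =
        pochhammer (3 * a) (2 * k + (n - k))"
      using that pochhammer_product'[of "3 * a" n k] by (simp add: add.commute[of k n])
    also have "\<dots> = pochhammer (3 * a) (2 * k) * pochhammer (3 * a + 2 * of_nat k) (n - k)"
      by (simp add: pochhammer_product')
    finally have split: "pochhammer (3 * a + of_nat n) k =
        pochhammer (3 * a) (2 * k) * pochhammer (3 * a + 2 * of_nat k) (n - k) / pochhammer (3 * a) n"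
      using a[of n] by (simp add: eq_divide_eq mult.commute)
    have ne: "pochhammer (3 * a / 2) k * pochhammer ((1 + 3 * a) / 2) k \<noteq> 0"
      using a[of "2 * k"] unfolding half by simp
    have "(- 3) ^ k = (- 1) ^ k * (3 ^ k :: 'a)" by (simp flip: power_mult_distrib)
    thus ?thesis unfolding neg split half using ne
      by (simp add: power_divide mult_ac)
  qed
  have "(\<Sum>k=0..n. pochhammer (- of_nat n) k * pochhammer a k * pochhammer (3 * a + of_nat n) k /
          (fact k * pochhammer (3 * a / 2) k * pochhammer ((1 + 3 * a) / 2) k) * (3 / 4) ^ k) =
      fact n / pochhammer (3 * a) n * (if 3 dvd n then pochhammer a (n div 3) / fact (n div 3) else 0)"
    unfolding gessel_stanton_coefficient[symmetric] sum_distrib_left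
    by (intro sum.cong refl term_eq) simp
  also have "\<dots> = (if 3 dvd n then pochhammer (1 / 3) (n div 3) * pochhammer (2 / 3) (n div 3) /
            (pochhammer (1 / 3 + a) (n div 3) * pochhammer (2 / 3 + a) (n div 3)) else 0)"
  \<comment> \<open>For \<open>n = 3 * m\<close>, triplication of \<open>fact n\<close> and of
    \<open>pochhammer (3 * a) n\<close> cancels \<open>27 ^ m\<close> as well as the quotient of
    \<open>pochhammer a m\<close> and \<open>fact m\<close>.\<close>
  proof (cases "3 dvd n")
    case True
    then obtain m where m: "n = 3 * m" by blast
    have "pochhammer a m \<noteq> 0" using a[of "3 * m"] unfolding pochhammer_triple by simp
    thus ?thesis unfolding m fact_triple pochhammer_triple by simp
  qed simp
  finally show ?thesis .
qed

section \<open>Nonreal parameters and their density\<close>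

lemma pochhammer_nonreal: "Im x \<noteq> 0 \<Longrightarrow> pochhammer x k \<noteq> 0"
  by (auto simp: pochhammer_eq_0_iff)

text \<open>A real \<open>a\<close> is the limit of the nonreal points a + i/(m + 1). Continuity is
  asked at \<open>a\<close> alone, which is what conditions on the denominators at \<open>a\<close>
  provide.\<close>

lemma isCont_eq_if_eq_off_Reals:
  fixes f g :: "complex \<Rightarrow> 'a::t2_space"
  assumes "isCont f a" "isCont g a" and eq: "\<And>x. Im x \<noteq> 0 \<Longrightarrow> f x = g x"
  shows "f a = g a"
proof (cases "Im a = 0")
  case True
  define s where "s = (\<lambda>m. a + \<i> * of_real (inverse (real (Suc m))))"
  have "s \<longlonglongrightarrow> a + \<i> * of_real 0"
    unfolding s_def by (intro tendsto_intros LIMSEQ_inverse_real_of_nat)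
  hence s: "s \<longlonglongrightarrow> a" by simp
  have "f (s m) = g (s m)" for m
    by (rule eq) (use True in \<open>simp add: s_def add_eq_0_iff\<close>)
  hence "(\<lambda>m. f (s m)) \<longlonglongrightarrow> g a"
    using isCont_tendsto_compose[OF assms(2) s] by simp
  thus ?thesis
    using isCont_tendsto_compose[OF assms(1) s] LIMSEQ_unique by blast
qed (rule eq)

section \<open>Reduction of general \<open>l\<close> to \<open>l = 0\<close>\<close>

text \<open>For fixed \<open>k\<close>, the dependence on \<open>i\<close> is that of the
  very-well-poised terms \<open>t i\<close>. Their closed form supplies the quotients that shift the
  parameters \<open>3 * a + of_nat n\<close> and \<open>(1 + 3 * a) / 2\<close> by
  \<open>l\<close>.\<close>

lemma hypergeometric_3F2_summand_expansion:
  fixes a :: complex and l n k :: nat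
  assumes a: "Im a \<noteq> 0"
  shows "pochhammer (- of_nat n) k * pochhammer a k *
           pochhammer (3 * a + of_nat n - of_nat l) k /
           (fact k * pochhammer (3 * a / 2) k * pochhammer ((1 + 3 * a) / 2 - of_nat l) k) * (3 / 4) ^ k =
         (pochhammer (1 - 3 * a - of_nat n) l * pochhammer ((1 - 3 * a) / 2 - of_nat n) l) /
         (pochhammer (1 - 3 * a - 2 * of_nat n) l * pochhammer ((1 - 3 * a) / 2) l) *
         (\<Sum>i = 0..l.
            (3 * a + 2 * of_nat n - 2 * of_nat i) / (3 * a + 2 * of_nat n) *
            ((pochhammer (- of_nat l) i * pochhammer (- of_nat n) i *
              pochhammer (- 2 * of_nat n - 3 * a) i) /
             (pochhammer 1 i * pochhammer (1 - of_nat n - 3 * a) i *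
              pochhammer (1 + of_nat l - 2 * of_nat n - 3 * a) i)) *
            (pochhammer (of_nat i - of_nat n) k * pochhammer a k *
              pochhammer (3 * a + of_nat n - of_nat i) k /
              (fact k * pochhammer (3 * a / 2) k * pochhammer ((1 + 3 * a) / 2) k) * (3 / 4) ^ k))"
proof -
  define A where "A = - 2 * of_nat n - 3 * a"
  define b where "b = (of_nat k - of_nat n :: complex)"
  define x where "x = (1 + 3 * a) / 2"
  define y where "y = pochhammer a k / (fact k * pochhammer (3 * a / 2) k) * (3 / 4) ^ k"
  define t where "t = (\<lambda>i. (A + 2 * of_nat i) / A *
      (pochhammer (- of_nat l) i * pochhammer b i * pochhammer A i /
            (fact i * pochhammer (1 + A - b) i * pochhammer (1 + A + of_nat l) i)))"
  have A_simps: "1 + A = 1 - 3 * a - 2 * of_nat n" "(1 + A) / 2 - b = 1 - x - of_nat k"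
      "1 + A - b = 1 - (3 * a + of_nat n) - of_nat k" "(1 + A) / 2 = (1 - 3 * a) / 2 - of_nat n"
      "1 - x = (1 - 3 * a) / 2" "1 - (3 * a + of_nat n) = 1 - 3 * a - of_nat n"
    by (simp_all add: A_def b_def x_def field_simps)
  have A_simps': "1 + A + of_nat l = 1 + of_nat l - 2 * of_nat n - 3 * a"
      "1 - of_nat n - 3 * a = 1 - (3 * a + of_nat n)"
    by (simp_all add: A_def)
  have ratio: "(3 * a + 2 * of_nat n - 2 * of_nat i) / (3 * a + 2 * of_nat n) = (A + 2 * of_nat i) / A" for i
    using minus_divide_divide[of "A + 2 * of_nat i" A] by (simp add: A_def algebra_simps)
  \<comment> \<open>Every argument here has as imaginary part a nonzero real multiple of
    \<open>Im a\<close>.\<close>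
  have ne: "pochhammer (1 + A) j \<noteq> 0" "pochhammer ((1 + A) / 2) j \<noteq> 0" "pochhammer A j \<noteq> 0"
    "pochhammer (1 + A - b) j \<noteq> 0" "pochhammer ((1 + A) / 2 - b) j \<noteq> 0" "pochhammer (1 - x) j \<noteq> 0"
    "pochhammer x j \<noteq> 0" "pochhammer (x - of_nat l) j \<noteq> 0" "pochhammer (1 - (3 * a + of_nat n)) j \<noteq> 0" for j
    by (rule pochhammer_nonreal; use a in \<open>simp add: A_def b_def x_def\<close>)+
  have sum_t: "(\<Sum>i=0..l. t i) = pochhammer (1 + A) l * pochhammer (1 - x - of_nat k) l /
      (pochhammer (1 - (3 * a + of_nat n) - of_nat k) l * pochhammer ((1 + A) / 2) l)"
    unfolding t_def A_simps(2,3)[symmetric] by (rule well_poised_4F3) (rule ne)+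
  have shift: "pochhammer (- of_nat n) k * pochhammer (3 * a + of_nat n) k * t i =
      (A + 2 * of_nat i) / A * (pochhammer (- of_nat l) i * pochhammer (- of_nat n) i * pochhammer A i /
        (pochhammer 1 i * pochhammer (1 - (3 * a + of_nat n)) i * pochhammer (1 + A + of_nat l) i)) *
      (pochhammer (of_nat i - of_nat n) k * pochhammer (3 * a + of_nat n - of_nat i) k)" for i
  proof -
    \<comment> \<open>Both sides are \<open>pochhammer (- of_nat n) (k + i)\<close>; this is the
      reason for choosing \<open>b\<close> as k - n.\<close>
    have 1: "pochhammer (- of_nat n) k * pochhammer b i =
        (pochhammer (- of_nat n) i * pochhammer (of_nat i - of_nat n) k :: complex)"
      using pochhammer_product'[of "- of_nat n :: complex" k i]
        pochhammer_product'[of "- of_nat n :: complex" i k]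
      by (simp add: b_def add.commute)
    have 2: "pochhammer (3 * a + of_nat n) k / pochhammer (1 + A - b) i =
        pochhammer (3 * a + of_nat n - of_nat i) k / pochhammer (1 - (3 * a + of_nat n)) i"
      using pochhammer_reflect_shift[of "3 * a + of_nat n" i k] ne(4,9)[of i] unfolding A_simps(3)
      by (simp add: frac_eq_eq mult.commute)
    have "pochhammer (- of_nat n) k * pochhammer (3 * a + of_nat n) k * t i =
      (A + 2 * of_nat i) / A * (pochhammer (- of_nat l) i * pochhammer A i /
        (fact i * pochhammer (1 + A + of_nat l) i)) *
      (pochhammer (- of_nat n) k * pochhammer b i) *
      (pochhammer (3 * a + of_nat n) k / pochhammer (1 + A - b) i)"
      unfolding t_def by (simp add: mult_ac)
    thus ?thesis unfolding 1 2 by (simp add: pochhammer_fact mult_ac)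
  qed
  have R1: "pochhammer (3 * a + of_nat n - of_nat l) k = pochhammer (3 * a + of_nat n) k *
      pochhammer (1 - (3 * a + of_nat n)) l / pochhammer (1 - (3 * a + of_nat n) - of_nat k) l"
    using pochhammer_reflect_shift[of "3 * a + of_nat n" l k] ne(4)[of l] unfolding A_simps(3)
    by (simp add: field_simps)
  have R2: "1 / pochhammer (x - of_nat l) k =
      pochhammer (1 - x - of_nat k) l / (pochhammer x k * pochhammer (1 - x) l)"
    using pochhammer_reflect_shift[of x l k] ne(5,6)[of l] ne(7,8)[of k] unfolding A_simps(2)
    by (simp add: frac_eq_eq mult_ac)
  have "pochhammer (- of_nat n) k * pochhammer a k *
           pochhammer (3 * a + of_nat n - of_nat l) k /
           (fact k * pochhammer (3 * a / 2) k * pochhammer (x - of_nat l) k) * (3 / 4) ^ k =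
        y * pochhammer (- of_nat n) k * pochhammer (3 * a + of_nat n - of_nat l) k *
          (1 / pochhammer (x - of_nat l) k)"
    by (simp add: y_def mult_ac)
  also have "\<dots> = pochhammer (1 - (3 * a + of_nat n)) l * pochhammer ((1 + A) / 2) l /
      (pochhammer (1 + A) l * pochhammer (1 - x) l) * (y / pochhammer x k *
      (pochhammer (- of_nat n) k * pochhammer (3 * a + of_nat n) k * (\<Sum>i=0..l. t i)))"
    unfolding R1 R2 sum_t using ne(1)[of l] ne(2)[of l] by (simp add: mult_ac)
  finally show ?thesis
    unfolding ratio sum_distrib_left[of _ t] shift
    \<comment> \<open>The term \<open>(1 - 3 * a) / 2 - of_nat n\<close> is folded to
      \<open>(1 + A) / 2\<close> before its subterm \<open>(1 - 3 * a) / 2\<close> is folded to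
      \<open>1 - x\<close>.\<close>
    unfolding A_simps' A_simps(4)[symmetric]
    unfolding A_simps(5,6)[symmetric] x_def[symmetric] A_simps(1)[symmetric] A_def[symmetric]
      sum_distrib_left
    by (simp add: y_def mult_ac)
qed


text \<open>After interchanging the sums, each inner sum over \<open>k\<close> is the evaluation for
  \<open>l = 0\<close> with \<open>n - i\<close> in place of \<open>n\<close>. Divisibility by 3 in
  that evaluation is what \<open>chi3\<close> records.\<close>

lemma hypergeometric_3F2_expansion_nonreal:
  fixes l n :: nat and a :: complex
  assumes a: "Im a \<noteq> 0"
  shows "(\<Sum>k=0..n. pochhammer (- of_nat n) k * pochhammer a k *
           pochhammer (3 * a + of_nat n - of_nat l) k /
           (fact k * pochhammer (3 * a / 2) k * pochhammer ((1 + 3 * a) / 2 - of_nat l) k) * (3 / 4) ^ k) =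
         (pochhammer (1 - 3 * a - of_nat n) l * pochhammer ((1 - 3 * a) / 2 - of_nat n) l) /
         (pochhammer (1 - 3 * a - 2 * of_nat n) l * pochhammer ((1 - 3 * a) / 2) l) *
         (\<Sum>i = 0..l.
            (3 * a + 2 * of_nat n - 2 * of_nat i) / (3 * a + 2 * of_nat n) *
            ((pochhammer (- of_nat l) i * pochhammer (- of_nat n) i *
              pochhammer (- 2 * of_nat n - 3 * a) i) /
             (pochhammer 1 i * pochhammer (1 - of_nat n - 3 * a) i *
              pochhammer (1 + of_nat l - 2 * of_nat n - 3 * a) i)) *
            ((shifted_factorial (1 / 3) ((int n - int i) div 3) *
              shifted_factorial (2 / 3) ((int n - int i) div 3)) /
             (shifted_factorial (1 / 3 + a) ((int n - int i) div 3) *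
              shifted_factorial (2 / 3 + a) ((int n - int i) div 3))) *
            chi3 (int n - int i))"
    (is "?lhs = ?C * (\<Sum>i = 0..l. ?w i * ?s i * chi3 (int n - int i))")
proof -
  define B where "B = (\<lambda>i k. pochhammer (of_nat i - of_nat n) k * pochhammer a k *
      pochhammer (3 * a + of_nat n - of_nat i) k /
      (fact k * pochhammer (3 * a / 2) k * pochhammer ((1 + 3 * a) / 2) k) * (3 / 4) ^ k)"
  have "?lhs = (\<Sum>k=0..n. ?C * (\<Sum>i=0..l. ?w i * B i k))"
    unfolding B_def by (intro sum.cong refl hypergeometric_3F2_summand_expansion a)
  also have "\<dots> = ?C * (\<Sum>i=0..l. ?w i * (\<Sum>k=0..n. B i k))"
    by (subst sum_distrib_left[symmetric], subst sum.swap) (simp only: sum_distrib_left)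
  also have "(\<Sum>i=0..l. ?w i * (\<Sum>k=0..n. B i k)) = (\<Sum>i = 0..l. ?w i * ?s i * chi3 (int n - int i))"
  proof (intro sum.cong refl)
    fix i
    show "?w i * (\<Sum>k=0..n. B i k) = ?w i * ?s i * chi3 (int n - int i)"
    proof (cases "i \<le> n")
      \<comment> \<open>For \<open>i > n\<close> the weight vanishes, whatever the shifted
        factorials with negative index are.\<close>
      case False
      hence "pochhammer (- of_nat n) i = (0 :: complex)"
        by (simp add: pochhammer_of_nat_eq_0_iff)
      thus ?thesis by simp
    next
      case True
      define j where "j = n - i"
      have j: "of_nat i - of_nat n = (- of_nat j :: complex)" "int n - int i = int j"
        "3 * a + of_nat n - of_nat i = 3 * a + of_nat j"
        using True by (simp_all add: j_def of_nat_diff)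
      \<comment> \<open>The factor \<open>pochhammer (- of_nat j) k\<close> is zero for
        \<open>k > j\<close>.\<close>
      have "(\<Sum>k=0..n. B i k) = (\<Sum>k=0..j. B i k)"
        by (rule sum.mono_neutral_right) (auto simp: B_def j pochhammer_of_nat_eq_0_iff j_def)
      also have "\<dots> = (if 3 dvd j then pochhammer (1 / 3) (j div 3) * pochhammer (2 / 3) (j div 3) /
            (pochhammer (1 / 3 + a) (j div 3) * pochhammer (2 / 3 + a) (j div 3)) else 0)"
        unfolding B_def j by (rule gessel_stanton) (use a in \<open>simp add: pochhammer_nonreal\<close>)
      also have "\<dots> = ?s i * chi3 (int n - int i)"
      proof -
        have "int j div 3 = int (j div 3)" by (simp add: zdiv_int)
        moreover have "3 dvd int j \<longleftrightarrow> 3 dvd j" by (metis int_dvd_int_iff of_nat_numeral)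
        ultimately show ?thesis unfolding j chi3_def shifted_factorial_def by simp
      qed
      finally show ?thesis by (simp only: mult.assoc)
    qed
  qed
  finally show ?thesis .
qed

section \<open>Extension to all admissible parameters\<close>

theorem theorem4:
  fixes l n :: nat and a :: complex
  assumes "\<And>k. k \<le> n \<Longrightarrow> pochhammer (3 * a / 2) k \<noteq> 0"
    and "\<And>k. k \<le> n \<Longrightarrow> pochhammer ((1 + 3 * a) / 2 - of_nat l) k \<noteq> 0"
    and "pochhammer (1 - 3 * a - 2 * of_nat n) l \<noteq> 0"
    and "pochhammer ((1 - 3 * a) / 2) l \<noteq> 0"
    and "3 * a + 2 * of_nat n \<noteq> 0"
    and "\<And>i. i \<le> l \<Longrightarrow> 3 dvd (int n - int i) \<Longrightarrow>
           pochhammer (1 - of_nat n - 3 * a) i \<noteq> 0"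
    and "\<And>i. i \<le> l \<Longrightarrow> 3 dvd (int n - int i) \<Longrightarrow>
           pochhammer (1 + of_nat l - 2 * of_nat n - 3 * a) i \<noteq> 0"
    and "\<And>i. i \<le> l \<Longrightarrow> 3 dvd (int n - int i) \<Longrightarrow>
           shifted_factorial (1 / 3 + a) ((int n - int i) div 3) \<noteq> 0"
    and "\<And>i. i \<le> l \<Longrightarrow> 3 dvd (int n - int i) \<Longrightarrow>
           shifted_factorial (2 / 3 + a) ((int n - int i) div 3) \<noteq> 0"
  shows "hypergeometric_3F2 (- of_nat n) a (3 * a + of_nat n - of_nat l)
           (3 * a / 2) ((1 + 3 * a) / 2 - of_nat l) (3 / 4) =
         (pochhammer (1 - 3 * a - of_nat n) l * pochhammer ((1 - 3 * a) / 2 - of_nat n) l) /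
         (pochhammer (1 - 3 * a - 2 * of_nat n) l * pochhammer ((1 - 3 * a) / 2) l) *
         (\<Sum>i = 0..l.
            (3 * a + 2 * of_nat n - 2 * of_nat i) / (3 * a + 2 * of_nat n) *
            ((pochhammer (- of_nat l) i * pochhammer (- of_nat n) i *
              pochhammer (- 2 * of_nat n - 3 * a) i) /
             (pochhammer 1 i * pochhammer (1 - of_nat n - 3 * a) i *
              pochhammer (1 + of_nat l - 2 * of_nat n - 3 * a) i)) *
            ((shifted_factorial (1 / 3) ((int n - int i) div 3) *
              shifted_factorial (2 / 3) ((int n - int i) div 3)) /
             (shifted_factorial (1 / 3 + a) ((int n - int i) div 3) *
              shifted_factorial (2 / 3 + a) ((int n - int i) div 3))) *
            chi3 (int n - int i))"
proof -
  define L where "L = (\<lambda>a :: complex. \<Sum>k=0..n.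
      pochhammer (- of_nat n) k * pochhammer a k *
           pochhammer (3 * a + of_nat n - of_nat l) k /
      (fact k * pochhammer (3 * a / 2) k * pochhammer ((1 + 3 * a) / 2 - of_nat l) k) * (3 / 4) ^ k)"
  define c where "c = (\<lambda>a :: complex.
      (pochhammer (1 - 3 * a - of_nat n) l * pochhammer ((1 - 3 * a) / 2 - of_nat n) l) /
      (pochhammer (1 - 3 * a - 2 * of_nat n) l * pochhammer ((1 - 3 * a) / 2) l))"
  define t where "t = (\<lambda>(a :: complex) i.
      (3 * a + 2 * of_nat n - 2 * of_nat i) / (3 * a + 2 * of_nat n) *
      ((pochhammer (- of_nat l) i * pochhammer (- of_nat n) i *
        pochhammer (- 2 * of_nat n - 3 * a) i) /
       (pochhammer 1 i * pochhammer (1 - of_nat n - 3 * a) i *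
        pochhammer (1 + of_nat l - 2 * of_nat n - 3 * a) i)) *
      ((shifted_factorial (1 / 3) ((int n - int i) div 3) *
        shifted_factorial (2 / 3) ((int n - int i) div 3)) /
       (shifted_factorial (1 / 3 + a) ((int n - int i) div 3) *
        shifted_factorial (2 / 3 + a) ((int n - int i) div 3))) *
      chi3 (int n - int i))"
  have poch: "isCont (\<lambda>x. pochhammer (f x) m) a" if "isCont f a" for f :: "complex \<Rightarrow> complex" and m
    using isCont_o2[OF that isCont_pochhammer] .
  \<comment> \<open>For \<open>i \<le> n\<close> the index is nonnegative, so the shifted factorial
    is a polynomial in \<open>x\<close> and hence continuous.\<close>
  have pos: "shifted_factorial x ((int n - int i) div 3) = pochhammer x ((n - i) div 3)"
    if "i \<le> n" for x i
    using that by (simp add: shifted_factorial_def nat_div_distrib nat_diff_distrib)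
  have "L a = c a * (\<Sum>i=0..l. t a i)"
  proof (rule isCont_eq_if_eq_off_Reals[where f = L and g = "\<lambda>a. c a * (\<Sum>i=0..l. t a i)"])
    show "isCont L a"
      unfolding L_def using assms(1,2) by (intro continuous_intros poch) auto
    have "isCont c a"
      unfolding c_def using assms(3,4) by (intro continuous_intros poch) auto
    moreover have "isCont (\<lambda>a. t a i) a" if "i \<in> {0..l}" for i
    \<comment> \<open>The conditions on the denominators of the summands speak of indices with
      \<open>3 dvd (int n - int i)\<close>. Otherwise \<open>chi3\<close> vanishes, and for
      \<open>i > n\<close> so does \<open>pochhammer (- of_nat n) i\<close>; then the summand is
      identically zero in \<open>a\<close> and thus continuous.\<close>
    proof (cases "i \<le> n \<and> 3 dvd (int n - int i)")
      case True
      hence "i \<le> l" "3 dvd (int n - int i)" "i \<le> n" using that by auto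
      note ne = assms(6-9)[OF this(1,2)]
      show ?thesis
        unfolding t_def pos[OF \<open>i \<le> n\<close>]
        using assms(5) ne(1,2) ne(3,4)[unfolded pos[OF \<open>i \<le> n\<close>]]
        by (intro continuous_intros poch) (auto simp: pochhammer_fact[symmetric])
    next
      case False
      hence "pochhammer (- of_nat n) i = (0 :: complex) \<or> chi3 (int n - int i) = 0"
        by (auto simp: pochhammer_of_nat_eq_0_iff chi3_def)
      hence "(\<lambda>a. t a i) = (\<lambda>a. 0)"
        by (auto simp: t_def)
      thus ?thesis by simp
    qed
    ultimately show "isCont (\<lambda>a. c a * (\<Sum>i=0..l. t a i)) a"
      by (intro continuous_intros)
  next
    show "L x = c x * (\<Sum>i=0..l. t x i)" if "Im x \<noteq> 0" for x
      unfolding L_def c_def t_def using hypergeometric_3F2_expansion_nonreal[OF that] .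
  qed
  moreover have "hypergeometric_3F2 (- of_nat n) a (3 * a + of_nat n - of_nat l)
      (3 * a / 2) ((1 + 3 * a) / 2 - of_nat l) (3 / 4) = L a"
    unfolding hypergeometric_3F2_def L_def
    by (rule suminf_finite) (auto simp: pochhammer_of_nat_eq_0_iff)
  ultimately show ?thesis unfolding c_def t_def by simp
qed

end
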